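(* Let $d\ge 3$, let $I_1,I_2\subset\mathbb R^d$ be two non-coplanar line segments, and let $$\mu=c_1\mathcal H^1\!\restriction_{I_1}+c_2\mathcal H^1\!\restriction_{I_2},\qquad c_1,c_2>0,$$ be a Borel probability measure. Then $\mu$ is a spectral measure and admits a spectrum contained in a straight line.
   Context: $\mathcal H^1$ is one-dimensional Hausdorff measure (arc length on line segments), and $\mathcal H^1\!\restriction_{E}$ is its restriction to $E$. Line segments are non-degenerate (positive length). Two line segments are non-coplanar if they are not contained in a common two-dimensional affine subspace of $\mathbb R^d$. A Borel probability measure $\mu$ on $\mathbb R^d$ is called a spectral measure if there is a countable set $\Lambda\subset\mathbb R^d$ (called a spectrum of $\mu$) such that $\{e^{2\pi i\langle\lambda,x\rangle}\}_{\lambda\in\Lambda}$ is an orthonormal basis of $L^2(\mu)$. *)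

theory Defs
  imports "HOL-Probability.Probability"
begin

(* Covers range over bounded sets only, since diameter is unspecified on unbounded sets.
   With diam(U)^1 and no further factor, the measure of a segment is its length. *)
definition hausdorff1_pre :: "real \<Rightarrow> 'a::metric_space set \<Rightarrow> ennreal" where
  "hausdorff1_pre \<delta> A =
     (INF U \<in> {U :: nat \<Rightarrow> 'a set. A \<subseteq> (\<Union>i. U i) \<and> (\<forall>i. bounded (U i) \<and> diameter (U i) \<le> \<delta>)}.
        \<Sum>i. ennreal (diameter (U i)))"

(* Defined on all subsets, as an outer measure; it is countably additive on the Borel sets. *)
definition hausdorff1 :: "'a::metric_space set \<Rightarrow> ennreal" where
  "hausdorff1 A = (SUP \<delta> \<in> {0<..}. hausdorff1_pre \<delta> A)"

(* Elements of L^2(M) are represented by square-integrable functions, without passing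
   to the quotient by almost everywhere equality. *)
definition L2_fun :: "'a measure \<Rightarrow> ('a \<Rightarrow> complex) set" where
  "L2_fun M = {f \<in> borel_measurable M. integrable M (\<lambda>x. (cmod (f x))\<^sup>2)}"

definition L2_inner :: "'a measure \<Rightarrow> ('a \<Rightarrow> complex) \<Rightarrow> ('a \<Rightarrow> complex) \<Rightarrow> complex" where
  "L2_inner M f g = (LINT x|M. f x * cnj (g x))"

definition L2_norm :: "'a measure \<Rightarrow> ('a \<Rightarrow> complex) \<Rightarrow> real" where
  "L2_norm M f = sqrt (LINT x|M. (cmod (f x))\<^sup>2)"

(* Orthonormal family whose finite linear combinations are dense. *)
definition L2_orthonormal_basis :: "'a measure \<Rightarrow> 'i set \<Rightarrow> ('i \<Rightarrow> 'a \<Rightarrow> complex) \<Rightarrow> bool" where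
  "L2_orthonormal_basis M I e \<longleftrightarrow>
     (\<forall>i\<in>I. e i \<in> L2_fun M) \<and>
     (\<forall>i\<in>I. \<forall>j\<in>I. L2_inner M (e i) (e j) = (if i = j then 1 else 0)) \<and>
     (\<forall>f\<in>L2_fun M. \<forall>\<epsilon>>0. \<exists>F a. finite F \<and> F \<subseteq> I \<and>
        L2_norm M (\<lambda>x. f x - (\<Sum>i\<in>F. a i * e i x)) < \<epsilon>)"

definition is_spectrum :: "'a::euclidean_space measure \<Rightarrow> 'a set \<Rightarrow> bool" where
  "is_spectrum \<mu> \<Lambda> \<longleftrightarrow> countable \<Lambda> \<and>
     L2_orthonormal_basis \<mu> \<Lambda> (\<lambda>l x. exp (2 * complex_of_real pi * \<i> * complex_of_real (l \<bullet> x)))"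

definition spectral_measure :: "'a::euclidean_space measure \<Rightarrow> bool" where
  "spectral_measure \<mu> \<longleftrightarrow> prob_space \<mu> \<and> sets \<mu> = sets borel \<and> (\<exists>\<Lambda>. is_spectrum \<mu> \<Lambda>)"

definition non_coplanar :: "'a::euclidean_space set \<Rightarrow> 'a set \<Rightarrow> bool" where
  "non_coplanar S T \<longleftrightarrow> \<not> (\<exists>P. affine P \<and> aff_dim P = 2 \<and> S \<subseteq> P \<and> T \<subseteq> P)"

definition straight_line :: "'a::euclidean_space set \<Rightarrow> bool" where
  "straight_line L \<longleftrightarrow> affine L \<and> aff_dim L = 1"

end

(* Put m_i = c_i |I_i|, so m_1 + m_2 = 1. By non-coplanarity q1 - p1, q2 - p2 and p2 - p1 are
   linearly independent, so some u has inner products m_1, m_2 and m_1 with them. Then x |-> <u, x>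
   maps I_1 and I_2 with constant speed onto two adjacent intervals of lengths m_1 and m_2, and
   pushes mu forward to Lebesgue measure on an interval of length 1. The exponentials with integer
   frequencies are an orthonormal basis there, so the integer multiples of u are a spectrum of mu.
   The Hausdorff measure of arbitrary Borel subsets of a segment is only bounded from below: this
   gives one inequality between two probability measures, hence equality. *)
theory Submission imports Defs begin

section \<open>Trigonometric polynomials: algebra and uniform approximation\<close>

abbreviation cexp :: "real \<Rightarrow> complex" where
  "cexp s \<equiv> exp (2 * complex_of_real pi * \<i> * complex_of_real s)"

abbreviation unit_interval_measure :: "real measure" where
  "unit_interval_measure \<equiv> lebesgue_on {0..1}"

text \<open>An inductive definition instead of finite sums: closure under products and the
  translation from polynomials in \<open>cexp t\<close> become plain inductions. Frequencies may
  repeat here; they are collected in \<open>trig_poly_eq_sum\<close>.\<close>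

inductive trig_poly :: "(real \<Rightarrow> complex) \<Rightarrow> bool" where
  monomial: "trig_poly (\<lambda>t. c * cexp (of_int n * t))"
| add: "trig_poly p \<Longrightarrow> trig_poly q \<Longrightarrow> trig_poly (\<lambda>t. p t + q t)"

lemma trig_poly_const: "trig_poly (\<lambda>t. c)"
  using trig_poly.monomial[of c 0] by simp

lemma cexp_add: "cexp (s + t) = cexp s * cexp t"
  by (simp add: ring_distribs exp_add)

lemma norm_cexp [simp]: "norm (cexp s) = 1"
  by (simp add: norm_exp_eq_Re)

lemma cnj_cexp: "cnj (cexp s) = cexp (- s)"
  by (simp add: exp_cnj)

lemma trig_poly_mult:
  assumes "trig_poly p" "trig_poly q"
  shows "trig_poly (\<lambda>t. p t * q t)"
  using assms
proof (induction p rule: trig_poly.induct)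
  case (monomial c n)
  from this show ?case
  proof (induction q rule: trig_poly.induct)
    case (monomial d m)
    have "(\<lambda>t. c * cexp (of_int n * t) * (d * cexp (of_int m * t))) = (\<lambda>t. (c * d) * cexp (of_int (n + m) * t))"
      by (simp add: fun_eq_iff ring_distribs exp_add)
    then show ?case
      by (simp only: trig_poly.monomial)
  next
    case (add p q)
    then show ?case
      using trig_poly.add by (simp add: ring_distribs)
  qed
next
  case (add p p')
  then show ?case
    using trig_poly.add by (simp add: ring_distribs)
qed

text \<open>Coefficients extended by zero to the union of the two frequency sets can be added. Each
  frequency then occurs once, as an expansion over an orthonormal family requires.\<close>

lemma trig_poly_eq_sum:
  assumes "trig_poly p"
  shows "\<exists>F a. finite F \<and> (\<forall>t. p t = (\<Sum>n\<in>F. a n * cexp (of_int n * t)))"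
  using assms
proof (induction p rule: trig_poly.induct)
  case (monomial c n)
  show ?case
    by (intro exI[of _ "{n}"] exI[of _ "\<lambda>_. c"]) auto
next
  case (add p q)
  obtain F a where p: "finite F" "\<And>t. p t = (\<Sum>n\<in>F. a n * cexp (of_int n * t))"
    using add.IH(1) by blast
  obtain G b where q: "finite G" "\<And>t. q t = (\<Sum>n\<in>G. b n * cexp (of_int n * t))"
    using add.IH(2) by blast
  let ?a = "\<lambda>n. (if n \<in> F then a n else 0) + (if n \<in> G then b n else 0)"
  have "p t + q t = (\<Sum>n\<in>F \<union> G. ?a n * cexp (of_int n * t))" for t
  proof -
    have "p t = (\<Sum>n\<in>F \<union> G. (if n \<in> F then a n else 0) * cexp (of_int n * t))"
      unfolding p(2) using p(1) q(1) by (intro sum.mono_neutral_cong_left) auto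
    moreover have "q t = (\<Sum>n\<in>F \<union> G. (if n \<in> G then b n else 0) * cexp (of_int n * t))"
      unfolding q(2) using p(1) q(1) by (intro sum.mono_neutral_cong_left) auto
    ultimately show ?thesis
      by (simp only: ring_distribs sum.distrib)
  qed
  then show ?case
    using p(1) q(1) by (intro exI[of _ "F \<union> G"] exI[of _ ?a]) auto
qed

lemma continuous_on_trig_poly: "trig_poly p \<Longrightarrow> continuous_on S p"
  by (induction rule: trig_poly.induct) (auto intro!: continuous_intros)

text \<open>A real linear functional on the plane has the form \<open>c * z + cnj (c * z)\<close>,
  and on the unit circle conjugation is inversion, so it only involves the frequencies 1 and -1.
  Sums and products then follow by induction.\<close>

lemma trig_poly_real_polynomial_function:
  assumes "real_polynomial_function g"
  shows "trig_poly (\<lambda>t. complex_of_real (g (cexp t)))"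
  using assms
proof (induction rule: real_polynomial_function.induct)
  case (linear f)
  interpret bounded_linear f by fact
  define c where "c = (complex_of_real (f 1) - \<i> * complex_of_real (f \<i>)) / 2"
  have "complex_of_real (f (cexp t)) = c * cexp (of_int 1 * t) + cnj c * cexp (of_int (-1) * t)" for t
  proof -
    have "cexp t = Re (cexp t) *\<^sub>R 1 + Im (cexp t) *\<^sub>R \<i>"
      by (simp add: complex_eq_iff)
    then have "f (cexp t) = Re (cexp t) * f 1 + Im (cexp t) * f \<i>"
      by (metis add scaleR real_scaleR_def)
    also have "complex_of_real \<dots> = c * cexp t + cnj (c * cexp t)"
      by (simp add: c_def complex_eq_iff field_simps)
    finally show ?thesis
      by (simp add: cnj_cexp)
  qed
  then show ?case
    using trig_poly.add[OF trig_poly.monomial[of c 1] trig_poly.monomial[of "cnj c" "-1"]] by simp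
next
  case (const c)
  show ?case by (rule trig_poly_const)
next
  case (add f g)
  then show ?case
    using trig_poly.add by simp
next
  case (mult f g)
  then show ?case
    using trig_poly_mult by simp
qed

text \<open>As \<open>g 0 = g 1\<close>, the function descends to a continuous function on the unit
  circle. Stone-Weierstrass approximates it there by a polynomial in the real and imaginary parts,
  which becomes a trigonometric polynomial when composed with \<open>cexp\<close>.\<close>

lemma trig_poly_uniform_approx:
  fixes g :: "real \<Rightarrow> complex"
  assumes cont: "continuous_on {0..1} g" and loop: "g 0 = g 1" and "\<epsilon> > 0"
  obtains p where "trig_poly p" and "\<And>t. t \<in> {0..1} \<Longrightarrow> norm (g t - p t) < \<epsilon>"
proof -
  have "path g" "pathfinish g = pathstart g"
    using cont loop by (auto simp: path_def pathfinish_def pathstart_def)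
  \<comment> \<open>The trivial homotopy serves only to obtain continuity on the circle: the
    parameter \<open>Arg2pi z / (2 * pi)\<close> jumps at 1, but its composition with a loop does
    not.\<close>
  then have "homotopic_loops UNIV g g"
    by (simp add: homotopic_loops_refl)
  then have "homotopic_with_canon (\<lambda>h. True) (sphere 0 1) UNIV
               (g \<circ> (\<lambda>z. Arg2pi z / (2 * pi))) (g \<circ> (\<lambda>z. Arg2pi z / (2 * pi)))"
    by (rule homotopic_loops_imp_homotopic_circlemaps)
  then have cont': "continuous_on (sphere 0 1) (g \<circ> (\<lambda>z. Arg2pi z / (2 * pi)))"
    using homotopic_with_imp_continuous by blast
  obtain h where h: "polynomial_function h"
    "\<forall>z\<in>sphere 0 1. norm ((g \<circ> (\<lambda>z. Arg2pi z / (2 * pi))) z - h z) < \<epsilon>"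
    using Stone_Weierstrass_polynomial_function[OF compact_sphere cont' \<open>\<epsilon> > 0\<close>] by blast
  define p where "p t = complex_of_real (Re (h (cexp t))) + \<i> * complex_of_real (Im (h (cexp t)))" for t
  have p_eq: "p t = h (cexp t)" for t
    by (simp add: p_def complex_eq flip: complex_eq)
  have "real_polynomial_function (Re \<circ> h)" "real_polynomial_function (Im \<circ> h)"
    using h(1) bounded_linear_Re bounded_linear_Im by (auto simp: polynomial_function_def)
  then have "trig_poly p"
    unfolding p_def
    using trig_poly_real_polynomial_function[of "Re \<circ> h"] trig_poly_real_polynomial_function[of "Im \<circ> h"]
    by (auto intro!: trig_poly.add trig_poly_mult trig_poly_const)
  moreover have "norm (g t - p t) < \<epsilon>" if t: "t \<in> {0..1}" for t
  proof -
    have "g (Arg2pi (cexp t) / (2 * pi)) = g t"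
    \<comment> \<open>\<open>Arg2pi\<close> takes values below \<open>2 * pi\<close>, so the
      parameter 1 is sent back to 0; there the loop condition is used.\<close>
    proof (cases "t = 1")
      case True
      then have "cexp t = 1"
        using exp_two_pi_i by simp
      then show ?thesis
        using True loop Arg2pi_of_real[of 1] by simp
    next
      case False
      have "Arg2pi (cexp t) = 2 * pi * t"
        using False t by (subst Arg2pi_exp) auto
      then show ?thesis by simp
    qed
    moreover have "cexp t \<in> sphere 0 1"
      by simp
    ultimately show ?thesis
      using h(2) p_eq by (metis comp_apply)
  qed
  ultimately show thesis
    by (rule that)
qed

section \<open>Orthogonality of the exponentials on the unit interval\<close>

lemma integral_cexp:
  "(LINT t|unit_interval_measure. cexp (of_int n * t)) = (if n = 0 then 1 else 0)"
proof -
  have "continuous_on {0..1} (\<lambda>t. cexp (of_int n * t))"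
    by (intro continuous_intros)
  then have "integrable unit_interval_measure (\<lambda>t. cexp (of_int n * t))"
    using continuous_imp_integrable_real by blast
  then have eq: "(LINT t|unit_interval_measure. cexp (of_int n * t)) = integral {0..1} (\<lambda>t. cexp (of_int n * t))"
    by (rule lebesgue_integral_eq_integral) simp
  show ?thesis
  proof (cases "n = 0")
    case True
    then show ?thesis using eq by simp
  next
    case False
    define w where "w = 2 * complex_of_real pi * \<i> * of_int n"
    have w: "w \<noteq> 0" using False by (simp add: w_def)
    have e: "cexp (of_int n * t) = exp (w * of_real t)" for t
      by (simp add: w_def mult_ac)
    have "((\<lambda>t. exp (w * of_real t) / w) has_vector_derivative exp (w * of_real t)) (at t within {0..1})" for t
      by (rule has_vector_derivative_real_field) (auto intro!: derivative_eq_intros simp: w)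
    then have "((\<lambda>t. exp (w * of_real t)) has_integral exp (w * of_real 1) / w - exp (w * of_real 0) / w) {0..1}"
      by (intro fundamental_theorem_of_calculus) auto
    \<comment> \<open>The antiderivative \<open>exp (w * t) / w\<close> takes equal values at both
      ends, since \<open>w\<close> is a nonzero integer multiple of the period of
      \<open>exp\<close>.\<close>
    moreover have "exp (w * of_real 1) = 1"
      using exp_eq_1[of w] by (auto simp: w_def)
    ultimately show ?thesis
      using eq False unfolding e by (simp add: integral_unique)
  qed
qed

section \<open>Density of trigonometric polynomials in the square-integrable functions\<close>

lemma L2_fun_add:
  assumes "u \<in> L2_fun M" "v \<in> L2_fun M"
  shows "(\<lambda>x. u x + v x) \<in> L2_fun M"
    and "(LINT x|M. (cmod (u x + v x))\<^sup>2) \<le> 2 * (LINT x|M. (cmod (u x))\<^sup>2) + 2 * (LINT x|M. (cmod (v x))\<^sup>2)"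
proof -
  have meas [measurable]: "u \<in> borel_measurable M" "v \<in> borel_measurable M"
    and int: "integrable M (\<lambda>x. (cmod (u x))\<^sup>2)" "integrable M (\<lambda>x. (cmod (v x))\<^sup>2)"
    using assms by (auto simp: L2_fun_def)
  \<comment> \<open>This pointwise bound takes the place of the Minkowski inequality, at the price
    of a factor 2 in each use.\<close>
  have bound: "(cmod (a + b))\<^sup>2 \<le> 2 * (cmod a)\<^sup>2 + 2 * (cmod b)\<^sup>2" for a b :: complex
  proof -
    have "(cmod (a + b))\<^sup>2 \<le> (cmod a + cmod b)\<^sup>2"
      by (intro power_mono norm_triangle_ineq) simp
    also have "\<dots> \<le> 2 * (cmod a)\<^sup>2 + 2 * (cmod b)\<^sup>2"
      using sum_squares_bound[of "cmod a" "cmod b"] by (simp add: power2_sum)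
    finally show ?thesis .
  qed
  have int2: "integrable M (\<lambda>x. 2 * (cmod (u x))\<^sup>2 + 2 * (cmod (v x))\<^sup>2)"
    using int by simp
  have int_add: "integrable M (\<lambda>x. (cmod (u x + v x))\<^sup>2)"
    by (rule Bochner_Integration.integrable_bound[OF int2]) (use bound in \<open>auto intro!: AE_I2\<close>)
  then show "(\<lambda>x. u x + v x) \<in> L2_fun M"
    by (simp add: L2_fun_def)
  have "(LINT x|M. (cmod (u x + v x))\<^sup>2) \<le> (LINT x|M. 2 * (cmod (u x))\<^sup>2 + 2 * (cmod (v x))\<^sup>2)"
    by (rule integral_mono[OF int_add int2 bound])
  then show "(LINT x|M. (cmod (u x + v x))\<^sup>2) \<le> 2 * (LINT x|M. (cmod (u x))\<^sup>2) + 2 * (LINT x|M. (cmod (v x))\<^sup>2)"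
    using int by simp
qed

lemma L2_fun_diff:
  assumes "u \<in> L2_fun M" "v \<in> L2_fun M"
  shows "(\<lambda>x. u x - v x) \<in> L2_fun M"
proof -
  have "(\<lambda>x. - v x) \<in> L2_fun M"
    using assms(2) by (simp add: L2_fun_def)
  from L2_fun_add(1)[OF assms(1) this] show ?thesis
    by simp
qed

lemma (in finite_measure) L2_fun_bounded:
  assumes [measurable]: "f \<in> borel_measurable M" and "\<And>x. x \<in> space M \<Longrightarrow> cmod (f x) \<le> B"
  shows "f \<in> L2_fun M"
proof -
  have "(cmod (f x))\<^sup>2 \<le> B\<^sup>2" if "x \<in> space M" for x
    using assms(2)[OF that] by (intro power_mono) auto
  then have "integrable M (\<lambda>x. (cmod (f x))\<^sup>2)"
    by (intro integrable_const_bound[where B = "B\<^sup>2"] AE_I2) auto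
  then show ?thesis
    by (simp add: L2_fun_def)
qed

text \<open>Dominated convergence with majorant the squared modulus of \<open>f\<close>: the
  difference is always \<open>f x\<close> or 0, and is 0 once \<open>n\<close> exceeds the modulus
  of \<open>f x\<close>.\<close>

lemma L2_truncation:
  assumes "f \<in> L2_fun M"
  shows "(\<lambda>n. LINT x|M. (cmod (f x - (if cmod (f x) \<le> real n then f x else 0)))\<^sup>2) \<longlonglongrightarrow> 0"
proof -
  have [measurable]: "f \<in> borel_measurable M" and int: "integrable M (\<lambda>x. (cmod (f x))\<^sup>2)"
    using assms by (auto simp: L2_fun_def)
  have "(\<lambda>n. LINT x|M. (cmod (f x - (if cmod (f x) \<le> real n then f x else 0)))\<^sup>2) \<longlonglongrightarrow> (LINT x|M. 0)"
  proof (rule integral_dominated_convergence[OF _ _ int])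
    have "(\<lambda>n. (cmod (f x - (if cmod (f x) \<le> real n then f x else 0)))\<^sup>2) \<longlonglongrightarrow> 0" for x
    proof (rule tendsto_eventually)
      obtain N where "cmod (f x) \<le> real N"
        using real_arch_simple by blast
      then show "\<forall>\<^sub>F n in sequentially. (cmod (f x - (if cmod (f x) \<le> real n then f x else 0)))\<^sup>2 = 0"
        by (intro eventually_sequentiallyI[of N]) auto
    qed
    then show "AE x in M. (\<lambda>n. (cmod (f x - (if cmod (f x) \<le> real n then f x else 0)))\<^sup>2) \<longlonglongrightarrow> 0"
      by simp
  qed auto
  then show ?thesis by simp
qed

text \<open>A Lebesgue measurable function is an almost everywhere limit of continuous ones. These
  are modified to be bounded by \<open>B\<close>, so that dominated convergence applies, and to
  vanish at both endpoints, so that the result is a loop and can be approximated uniformly.\<close>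

lemma L2_approx_continuous:
  fixes f :: "real \<Rightarrow> complex"
  assumes f [measurable]: "f \<in> borel_measurable unit_interval_measure"
    and B: "B > 0" "\<And>t. t \<in> {0..1} \<Longrightarrow> cmod (f t) \<le> B" and "\<epsilon> > 0"
  obtains g where "continuous_on UNIV g" "g 0 = 0" "g 1 = 0"
    "(LINT t|unit_interval_measure. (cmod (f t - g t))\<^sup>2) < \<epsilon>"
proof -
  have "f measurable_on {0..1}"
    using f by (simp add: measurable_on_iff_borel_measurable)
  then obtain N g where N: "negligible N" and g: "\<And>n. continuous_on UNIV (g n)"
    "\<And>t. t \<notin> N \<Longrightarrow> (\<lambda>n. g n t) \<longlonglongrightarrow> (if t \<in> {0..1} then f t else 0)"
    unfolding measurable_on_def by blast
  \<comment> \<open>\<open>clip\<close> is the radial retraction onto the closed disc of radius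
    \<open>B\<close>, which contains the values of \<open>f\<close>. The factor \<open>cut n\<close>
    vanishes at 0 and 1 and is eventually 1 at each interior point.\<close>
  define clip where "clip z = z / complex_of_real (max 1 (cmod z / B))" for z :: complex
  define cut where "cut n t = min 1 (real n * (t * (1 - t)))" for n :: nat and t :: real
  define h where "h n t = clip (g n t) * complex_of_real (cut n t)" for n t
  have clip_le: "cmod (clip z) \<le> B" for z
    using B(1) by (simp add: clip_def norm_divide field_simps max_def)
  have clip_id: "clip z = z" if "cmod z \<le> B" for z
    using that B(1) by (simp add: clip_def max_def field_simps)
  have clip_cont: "continuous_on UNIV clip"
    unfolding clip_def using B(1) by (intro continuous_intros) auto
  have cut_le: "\<bar>cut n t\<bar> \<le> 1" if "t \<in> {0..1}" for n t
    using that by (auto simp: cut_def)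
  have h_cont: "continuous_on UNIV (h n)" for n
    unfolding h_def cut_def
    by (intro continuous_intros continuous_on_compose2[OF clip_cont g(1)]) auto
  have h_le: "cmod (h n t) \<le> B" if "t \<in> {0..1}" for n t
  proof -
    have "cmod (h n t) \<le> B * 1"
      unfolding h_def norm_mult using clip_le cut_le[OF that] B(1) by (intro mult_mono) auto
    then show ?thesis by simp
  qed
  have h_meas [measurable]: "h n \<in> borel_measurable unit_interval_measure" for n
    using continuous_on_subset[OF h_cont]
    by (intro continuous_imp_measurable_on_sets_lebesgue) auto
  have lim: "(\<lambda>n. h n t) \<longlonglongrightarrow> f t" if t: "t \<notin> N" "t \<in> {0<..<1}" for t
  proof -
    have "(\<lambda>n. clip (g n t)) \<longlonglongrightarrow> clip (f t)"
      using g(2)[OF t(1)] t(2) clip_cont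
      by (intro continuous_on_tendsto_compose[OF clip_cont]) auto
    moreover have "(\<lambda>n. cut n t) \<longlonglongrightarrow> 1"
    proof (rule tendsto_eventually)
      have pos: "t * (1 - t) > 0" using t(2) by simp
      obtain n0 where n0: "1 < real n0 * (t * (1 - t))"
        using reals_Archimedean3[OF pos] by blast
      show "\<forall>\<^sub>F n in sequentially. cut n t = 1"
      proof (rule eventually_sequentiallyI[of n0])
        fix n assume "n0 \<le> n"
        then have "real n0 * (t * (1 - t)) \<le> real n * (t * (1 - t))"
          using pos by (intro mult_right_mono) auto
        then show "cut n t = 1" using n0 by (simp add: cut_def)
      qed
    qed
    ultimately have "(\<lambda>n. h n t) \<longlonglongrightarrow> clip (f t) * complex_of_real 1"
      unfolding h_def by (intro tendsto_intros)
    then show ?thesis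
      using clip_id B(2)[of t] t(2) by simp
  qed
  have "(\<lambda>n. LINT t|unit_interval_measure. (cmod (f t - h n t))\<^sup>2) \<longlonglongrightarrow> (LINT t|unit_interval_measure. 0)"
  proof (rule integral_dominated_convergence[where w = "\<lambda>_. (2 * B)\<^sup>2"])
    \<comment> \<open>The endpoints join the exceptional set because \<open>h n\<close> is 0 there,
      whatever the value of \<open>f\<close>.\<close>
    have "N \<union> {0, 1} \<in> null_sets lebesgue"
      using N by (simp add: negligible_iff_null_sets negligible_Un flip: negligible_iff_null_sets)
    then have "AE t in lebesgue. t \<notin> N \<union> {0, 1}"
      by (rule AE_not_in)
    then have "AE t in unit_interval_measure. t \<notin> N \<union> {0, 1}"
      by (auto simp: AE_restrict_space_iff)
    then show "AE t in unit_interval_measure. (\<lambda>n. (cmod (f t - h n t))\<^sup>2) \<longlonglongrightarrow> 0"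
      using AE_space
    proof eventually_elim
      case (elim t)
      then have "(\<lambda>n. h n t) \<longlonglongrightarrow> f t"
        by (intro lim) auto
      then have "(\<lambda>n. (cmod (f t - h n t))\<^sup>2) \<longlonglongrightarrow> (cmod (f t - f t))\<^sup>2"
        by (intro tendsto_intros)
      then show ?case by simp
    qed
    fix n
    have "(cmod (f t - h n t))\<^sup>2 \<le> (2 * B)\<^sup>2" if "t \<in> {0..1}" for t
      using norm_triangle_ineq4[of "f t" "h n t"] B(2)[OF that] h_le[OF that, of n]
      by (intro power_mono) auto
    then show "AE t in unit_interval_measure. norm ((cmod (f t - h n t))\<^sup>2) \<le> (2 * B)\<^sup>2"
      by (intro AE_I2) simp
  qed auto
  then have "\<forall>\<^sub>F n in sequentially. (LINT t|unit_interval_measure. (cmod (f t - h n t))\<^sup>2) < \<epsilon>"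
    using \<open>\<epsilon> > 0\<close> by (intro order_tendstoD(2)) auto
  then obtain n where "(LINT t|unit_interval_measure. (cmod (f t - h n t))\<^sup>2) < \<epsilon>"
    by (auto simp: eventually_sequentially)
  moreover have "h n 0 = 0" "h n 1 = 0"
    by (auto simp: h_def cut_def)
  ultimately show thesis
    using that h_cont by blast
qed

interpretation unit_interval: prob_space unit_interval_measure
  by (rule prob_spaceI) (simp add: emeasure_restrict_space)

lemma continuous_on_in_L2_fun:
  fixes g :: "real \<Rightarrow> complex"
  assumes "continuous_on UNIV g"
  shows "g \<in> L2_fun unit_interval_measure"
proof -
  have cont: "continuous_on {0..1} g"
    using assms continuous_on_subset by blast
  then have "compact (g ` {0..1})"
    by (rule compact_continuous_image) simp
  then obtain B where "\<And>t. t \<in> {0..1} \<Longrightarrow> cmod (g t) \<le> B"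
    by (meson bounded_iff compact_imp_bounded imageI)
  moreover have "g \<in> borel_measurable unit_interval_measure"
    using cont by (rule continuous_imp_measurable_on_sets_lebesgue) simp
  ultimately show ?thesis
    by (intro unit_interval.L2_fun_bounded[of _ B]) auto
qed

text \<open>Three successive approximations: truncation to a bounded function, a continuous function
  vanishing at the endpoints, and a uniformly close trigonometric polynomial.\<close>

lemma trig_poly_dense:
  assumes f: "f \<in> L2_fun unit_interval_measure" and "\<epsilon> > 0"
  obtains p where "trig_poly p" "L2_norm unit_interval_measure (\<lambda>t. f t - p t) < \<epsilon>"
proof -
  let ?M = unit_interval_measure
  \<comment> \<open>Each of the three squared errors is at most \<open>\<eta>\<close>. Two uses of
    the inequality with factor 2 give a total below
    \<open>2 * \<eta> + 4 * \<eta> + 4 * \<eta>\<close>, that is 10/16 of the square of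
    \<open>\<epsilon>\<close>.\<close>
  define \<eta> where "\<eta> = (\<epsilon> / 4)\<^sup>2"
  have \<eta>: "\<eta> > 0" using \<open>\<epsilon> > 0\<close> by (simp add: \<eta>_def)
  have [measurable]: "f \<in> borel_measurable ?M"
    using f by (simp add: L2_fun_def)
  obtain n where n: "(LINT t|?M. (cmod (f t - (if cmod (f t) \<le> real n then f t else 0)))\<^sup>2) < \<eta>"
    using order_tendstoD(2)[OF L2_truncation[OF f] \<eta>] by (auto simp: eventually_sequentially)
  define f' where "f' t = (if cmod (f t) \<le> real n then f t else 0)" for t
  have f'_meas [measurable]: "f' \<in> borel_measurable ?M"
    unfolding f'_def by measurable
  \<comment> \<open>One is added because the bound has to be positive even when
    \<open>n = 0\<close>.\<close>
  have f'_le: "cmod (f' t) \<le> real n + 1" for t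
    by (simp add: f'_def)
  obtain g where g: "continuous_on UNIV g" "g 0 = 0" "g 1 = 0" "(LINT t|?M. (cmod (f' t - g t))\<^sup>2) < \<eta>"
    using L2_approx_continuous[OF f'_meas _ f'_le \<eta>] by auto
  obtain p where p: "trig_poly p" "\<And>t. t \<in> {0..1} \<Longrightarrow> cmod (g t - p t) < \<epsilon> / 4"
    using trig_poly_uniform_approx[of g "\<epsilon> / 4"] g \<open>\<epsilon> > 0\<close> continuous_on_subset[of UNIV g "{0..1}"] by auto
  have L2: "f' \<in> L2_fun ?M" "g \<in> L2_fun ?M" "p \<in> L2_fun ?M"
    using g(1) p(1) unit_interval.L2_fun_bounded[OF f'_meas f'_le]
    by (auto intro: continuous_on_in_L2_fun continuous_on_trig_poly)
  have gp: "(LINT t|?M. (cmod (g t - p t))\<^sup>2) \<le> \<eta>"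
  proof -
    have "(cmod (g t - p t))\<^sup>2 \<le> \<eta>" if "t \<in> {0..1}" for t
      using p(2)[OF that] unfolding \<eta>_def by (intro power_mono) auto
    then show ?thesis
      using L2_fun_diff[OF L2(2,3)]
      by (intro unit_interval.integral_le_const AE_I2) (auto simp: L2_fun_def)
  qed
  have "(LINT t|?M. (cmod (f t - p t))\<^sup>2)
      \<le> 2 * (LINT t|?M. (cmod (f t - f' t))\<^sup>2) + 2 * (LINT t|?M. (cmod (f' t - p t))\<^sup>2)"
    using L2_fun_add(2)[OF L2_fun_diff[OF f L2(1)] L2_fun_diff[OF L2(1) L2(3)]] by simp
  moreover have "(LINT t|?M. (cmod (f' t - p t))\<^sup>2)
      \<le> 2 * (LINT t|?M. (cmod (f' t - g t))\<^sup>2) + 2 * (LINT t|?M. (cmod (g t - p t))\<^sup>2)"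
    using L2_fun_add(2)[OF L2_fun_diff[OF L2(1,2)] L2_fun_diff[OF L2(2,3)]] by simp
  moreover have "(LINT t|?M. (cmod (f t - f' t))\<^sup>2) < \<eta>"
    using n by (simp add: f'_def)
  ultimately have "(LINT t|?M. (cmod (f t - p t))\<^sup>2) < 10 * \<eta>"
    using g(4) gp by linarith
  also have "\<dots> \<le> \<epsilon>\<^sup>2"
    by (simp add: \<eta>_def power_divide)
  finally have "L2_norm ?M (\<lambda>t. f t - p t) < \<epsilon>"
    using \<open>\<epsilon> > 0\<close> unfolding L2_norm_def by (simp add: real_less_lsqrt)
  with p(1) show thesis by (rule that)
qed

section \<open>Bounds for one-dimensional Hausdorff measure\<close>

lemma subset_interval_if_dist_le:
  fixes T :: "real set"
  assumes "\<And>s t. s \<in> T \<Longrightarrow> t \<in> T \<Longrightarrow> \<bar>s - t\<bar> \<le> d"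
  obtains a where "T \<subseteq> {a..a + d}"
proof (cases "T = {}")
  case False
  have lower: "t - d \<le> s" if "s \<in> T" "t \<in> T" for s t
    using assms[OF that] by linarith
  have bdd: "bdd_below T"
    using False lower by (meson bdd_belowI ex_in_conv)
  have "T \<subseteq> {Inf T..Inf T + d}"
  proof
    fix t assume t: "t \<in> T"
    have "t - d \<le> Inf T"
      using False lower t by (intro cInf_greatest) auto
    then show "t \<in> {Inf T..Inf T + d}"
      using cInf_lower[OF t bdd] by auto
  qed
  then show thesis by (rule that)
qed (use that in auto)

text \<open>A cover of \<open>A\<close> pulls back along \<open>\<gamma>\<close> to a cover of
  \<open>S\<close> whose pieces have diameters smaller by the factor \<open>k\<close>. The pieces
  may be non-measurable, so each is enlarged to an interval of length
  \<open>diameter (U i) / k\<close> before subadditivity is applied.\<close>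

lemma emeasure_le_hausdorff1:
  fixes \<gamma> :: "real \<Rightarrow> 'a::metric_space"
  assumes "S \<in> sets borel" and k: "k > 0"
    and expand: "\<And>s t. s \<in> S \<Longrightarrow> t \<in> S \<Longrightarrow> k * \<bar>s - t\<bar> \<le> dist (\<gamma> s) (\<gamma> t)"
    and img: "\<gamma> ` S \<subseteq> A"
  shows "ennreal k * emeasure lborel S \<le> hausdorff1 A"
proof -
  have "ennreal k * emeasure lborel S \<le> (\<Sum>i. ennreal (diameter (U i)))"
    if cover: "A \<subseteq> (\<Union>i. U i)" and bdd: "\<And>i. bounded (U i)" for U :: "nat \<Rightarrow> 'a set"
  proof -
    have "\<exists>a. S \<inter> \<gamma> -` U i \<subseteq> {a..a + diameter (U i) / k}" for i
    proof -
      have "\<bar>s - t\<bar> \<le> diameter (U i) / k" if "s \<in> S \<inter> \<gamma> -` U i" "t \<in> S \<inter> \<gamma> -` U i" for s t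
      proof -
        have "k * \<bar>s - t\<bar> \<le> dist (\<gamma> s) (\<gamma> t)"
          using that by (intro expand) auto
        also have "\<dots> \<le> diameter (U i)"
          using that bdd by (intro diameter_bounded_bound) auto
        finally show ?thesis
          using k by (simp add: field_simps)
      qed
      then show ?thesis
        by (metis subset_interval_if_dist_le)
    qed
    then obtain a where a: "\<And>i. S \<inter> \<gamma> -` U i \<subseteq> {a i..a i + diameter (U i) / k}"
      by metis
    have d: "diameter (U i) / k \<ge> 0" for i
      using k bdd by (simp add: diameter_ge_0)
    have "S \<subseteq> (\<Union>i. {a i..a i + diameter (U i) / k})"
    proof
      fix s assume s: "s \<in> S"
      then obtain i where "\<gamma> s \<in> U i"
        using img cover by blast
      then show "s \<in> (\<Union>i. {a i..a i + diameter (U i) / k})"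
        using s a[of i] by blast
    qed
    then have "emeasure lborel S \<le> emeasure lborel (\<Union>i. {a i..a i + diameter (U i) / k})"
      by (intro emeasure_mono) auto
    also have "\<dots> \<le> (\<Sum>i. emeasure lborel {a i..a i + diameter (U i) / k})"
      by (intro emeasure_subadditive_countably) auto
    also have "\<dots> = (\<Sum>i. ennreal (diameter (U i) / k))"
      using d by simp
    finally have "ennreal k * emeasure lborel S \<le> ennreal k * (\<Sum>i. ennreal (diameter (U i) / k))"
      by (rule mult_left_mono) simp
    also have "\<dots> = (\<Sum>i. ennreal (diameter (U i)))"
      using k d by (simp flip: ennreal_suminf_cmult ennreal_mult)
    finally show ?thesis .
  qed
  \<comment> \<open>A single scale suffices, here 1: the estimate holds for all covers by bounded
    sets, and \<open>hausdorff1\<close> is the supremum over the scales.\<close>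
  then have "ennreal k * emeasure lborel S \<le> hausdorff1_pre 1 A"
    unfolding hausdorff1_pre_def by (intro INF_greatest) auto
  also have "\<dots> \<le> hausdorff1 A"
    unfolding hausdorff1_def by (intro SUP_upper) auto
  finally show ?thesis .
qed

text \<open>For every scale the segment splits into \<open>n\<close> equal pieces of diameter at
  most \<open>\<delta>\<close>, whose diameters add up to at most its length.\<close>

lemma hausdorff1_closed_segment_le:
  fixes p q :: "'a::real_normed_vector"
  shows "hausdorff1 (closed_segment p q) \<le> ennreal (dist p q)"
  unfolding hausdorff1_def
proof (rule SUP_least)
  fix \<delta> :: real assume "\<delta> \<in> {0<..}"
  then obtain n where n: "dist p q < real n * \<delta>"
    using reals_Archimedean3 by auto
  then have n0: "n > 0"
    using gr0I by fastforce
  define \<gamma> where "\<gamma> t = p + t *\<^sub>R (q - p)" for t :: real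
  \<comment> \<open>Covers are infinite sequences, so the \<open>n\<close> pieces are padded with
    empty sets, of diameter 0.\<close>
  define U where "U i = (if i < n then \<gamma> ` {real i / n..(real i + 1) / n} else {})" for i
  have seg: "closed_segment p q = \<gamma> ` {0..1}"
    by (simp add: \<gamma>_def closed_segment_image_interval algebra_simps)
  have \<gamma>_norm: "norm (\<gamma> s - \<gamma> t) = \<bar>s - t\<bar> * dist p q" for s t
    by (simp add: \<gamma>_def dist_norm norm_minus_commute flip: scaleR_left_diff_distrib)
  have diam: "diameter (U i) \<le> dist p q / n" for i
  proof (rule diameter_le)
    fix x y assume xy: "x \<in> U i" "y \<in> U i"
    then have "i < n" by (auto simp: U_def split: if_splits)
    with xy obtain s t where st: "x = \<gamma> s" "y = \<gamma> t"
      "s \<in> {real i / n..(real i + 1) / n}" "t \<in> {real i / n..(real i + 1) / n}"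
      by (auto simp: U_def)
    then have "\<bar>s - t\<bar> \<le> (real i + 1) / n - real i / n"
      by auto
    then have "\<bar>s - t\<bar> \<le> 1 / n"
      by (simp flip: diff_divide_distrib)
    then have "\<bar>s - t\<bar> * dist p q \<le> 1 / n * dist p q"
      by (rule mult_right_mono) simp
    then show "norm (x - y) \<le> dist p q / n"
      by (simp add: st \<gamma>_norm)
  qed simp
  have "continuous_on S \<gamma>" for S
    unfolding \<gamma>_def by (intro continuous_intros)
  then have bdd: "bounded (U i)" for i
    by (auto simp: U_def intro!: compact_imp_bounded compact_continuous_image)
  have cover: "closed_segment p q \<subseteq> (\<Union>i. U i)"
  proof
    fix x assume "x \<in> closed_segment p q"
    then obtain t where t: "x = \<gamma> t" "0 \<le> t" "t \<le> 1"
      by (auto simp: seg)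
    \<comment> \<open>At \<open>t = 1\<close> the floor would give \<open>n\<close>, one past the
      last piece.\<close>
    define i where "i = (if t = 1 then n - 1 else nat \<lfloor>t * n\<rfloor>)"
    have "i < n \<and> t \<in> {real i / n..(real i + 1) / n}"
    proof (cases "t = 1")
      case True
      then show ?thesis using n0 by (auto simp: i_def field_simps of_nat_diff)
    next
      case False
      then have "t * n < n" using t n0 by simp
      moreover have "real i = of_int \<lfloor>t * n\<rfloor>"
        using False t by (simp add: i_def)
      ultimately have "real i \<le> t * n" "t * n < real i + 1" "real i < real n"
        by linarith+
      then show ?thesis using n0 by (auto simp: field_simps)
    qed
    then show "x \<in> (\<Union>i. U i)"
      unfolding t(1) U_def by (intro UN_I[of i]) auto
  qed
  have "(\<Sum>i. ennreal (diameter (U i))) = (\<Sum>i<n. ennreal (diameter (U i)))"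
    by (rule suminf_finite) (auto simp: U_def)
  also have "\<dots> \<le> (\<Sum>i<n. ennreal (dist p q / n))"
    using diam by (intro sum_mono ennreal_leI) auto
  also have "\<dots> = ennreal (dist p q)"
    using n0 by (simp add: ennreal_of_nat_eq_real_of_nat flip: ennreal_mult)
  finally have sum: "(\<Sum>i. ennreal (diameter (U i))) \<le> ennreal (dist p q)" .
  have "dist p q / n \<le> \<delta>"
    using n n0 by (simp add: field_simps)
  then have "diameter (U i) \<le> \<delta>" for i
    using diam[of i] by linarith
  then show "hausdorff1_pre \<delta> (closed_segment p q) \<le> ennreal (dist p q)"
    unfolding hausdorff1_pre_def using cover bdd sum by (intro INF_lower2[of U]) auto
qed

section \<open>Linear algebra of non-coplanar segments\<close>

text \<open>If the three directions spanned at most a plane, the translate of a two-dimensional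
  subspace through \<open>p1\<close> would contain all four endpoints, hence both segments. The
  cardinality is recorded as well, because in set notation coinciding vectors would
  collapse.\<close>

lemma non_coplanar_imp_independent:
  fixes p1 q1 p2 q2 :: "'a::euclidean_space"
  assumes "DIM('a) \<ge> 2"
    and "non_coplanar (closed_segment p1 q1) (closed_segment p2 q2)"
  shows "independent {q1 - p1, q2 - p2, p2 - p1}" and "card {q1 - p1, q2 - p2, p2 - p1} = 3"
proof -
  let ?B = "{q1 - p1, q2 - p2, p2 - p1}"
  have "dim ?B \<ge> 3"
  proof (rule ccontr)
    assume "\<not> dim ?B \<ge> 3"
    then have "dim ?B \<le> 2" by simp
    \<comment> \<open>The span may have dimension below 2, while \<open>non_coplanar\<close> speaks
      of dimension exactly 2. A basis of it is therefore enlarged, inside a basis of the whole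
      space, to two vectors.\<close>
    obtain C where C: "?B \<subseteq> C" "subspace C" "dim C = 2"
    proof -
      obtain B where B: "B \<subseteq> ?B" "independent B" "?B \<subseteq> span B" "card B = dim ?B"
        using basis_exists by blast
      obtain D where D: "B \<subseteq> D" "independent D" "UNIV \<subseteq> span D"
        by (rule maximal_independent_subset_extend[OF subset_UNIV B(2)])
      have "card D = DIM('a)"
        using D by (metis basis_card_eq_dim dim_UNIV subset_UNIV)
      then obtain E where E: "B \<subseteq> E" "E \<subseteq> D" "card E = 2"
        using exists_subset_between[of B 2 D] D B \<open>dim ?B \<le> 2\<close> assms(1)
        by (metis independent_imp_finite)
      have "dim (span E) = 2"
        using E D by (metis dim_span dim_eq_card_independent independent_mono)
      moreover have "?B \<subseteq> span E"
        using B(3) E(1) span_mono by blast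
      ultimately show thesis using that by blast
    qed
    define P where "P = (+) p1 ` C"
    have mem: "x \<in> P" if "x - p1 \<in> C" for x
      unfolding P_def using that by (intro image_eqI[of _ _ "x - p1"]) auto
    have "affine P"
      unfolding P_def using C(2) affine_translation subspace_imp_affine by blast
    moreover have "aff_dim P = 2"
      unfolding P_def using C by (simp add: aff_dim_translation_eq aff_dim_subspace)
    moreover have "p1 \<in> P" "q1 \<in> P" "p2 \<in> P"
      using C subspace_0[OF C(2)] by (auto intro!: mem)
    moreover have "q2 \<in> P"
      using C subspace_add[OF C(2), of "q2 - p2" "p2 - p1"] by (intro mem) auto
    ultimately have "\<exists>P. affine P \<and> aff_dim P = 2 \<and> closed_segment p1 q1 \<subseteq> P \<and> closed_segment p2 q2 \<subseteq> P"
      by (metis affine_imp_convex closed_segment_subset)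
    then show False
      using assms(2) by (simp add: non_coplanar_def)
  qed
  moreover have "card ?B \<le> 3"
    by (simp add: card_insert_if)
  moreover have "dim ?B \<le> card ?B"
    by (rule dim_le_card') simp
  ultimately show "card ?B = 3" "independent ?B"
    using card_eq_dim[of ?B ?B] by (auto simp: span_superset)
qed

lemma inner_values_on_triple:
  fixes a b c :: "'a::euclidean_space"
  assumes "independent {a, b, c}" and "card {a, b, c} = 3"
  obtains u where "u \<bullet> a = x" and "u \<bullet> b = y" and "u \<bullet> c = z"
proof -
  have ne: "a \<noteq> b" "a \<noteq> c" "b \<noteq> c"
    using assms(2) by (auto simp: card_insert_if split: if_splits)
  define h where "h v = (if v = a then x else if v = b then y else z)" for v
  obtain g where g: "linear g" "\<forall>v\<in>{a, b, c}. g v = h v"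
    using linear_independent_extend[OF assms(1), of h] by auto
  \<comment> \<open>\<open>adjoint g 1\<close> is the Riesz vector of the functional
    \<open>g\<close>, which has the prescribed values on the triple.\<close>
  have "adjoint g 1 \<bullet> v = g v" for v
    using adjoint_works[OF g(1), of v 1] by (simp add: inner_commute)
  then show thesis
    using g(2) ne by (intro that[of "adjoint g 1"]) (auto simp: h_def)
qed

section \<open>Hausdorff measure of segments and of their subsets\<close>

lemma hausdorff1_closed_segment:
  fixes p q :: "'a::real_normed_vector"
  shows "hausdorff1 (closed_segment p q) = ennreal (dist p q)"
proof (rule antisym[OF hausdorff1_closed_segment_le])
  show "ennreal (dist p q) \<le> hausdorff1 (closed_segment p q)"
  proof (cases "p = q")
    case False
    have "ennreal (dist p q) * emeasure lborel {0..1::real} \<le> hausdorff1 (closed_segment p q)"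
    proof (rule emeasure_le_hausdorff1[where \<gamma> = "\<lambda>t. p + t *\<^sub>R (q - p)"])
      show "dist p q * \<bar>s - t\<bar> \<le> dist (p + s *\<^sub>R (q - p)) (p + t *\<^sub>R (q - p))" for s t
        by (simp add: dist_norm norm_minus_commute mult.commute flip: scaleR_left_diff_distrib)
      show "(\<lambda>t. p + t *\<^sub>R (q - p)) ` {0..1} \<subseteq> closed_segment p q"
        by (auto simp: closed_segment_image_interval algebra_simps)
    qed (use False in auto)
    then show ?thesis by simp
  qed simp
qed

text \<open>The interval of length \<open>m\<close> traverses the segment with speed
  \<open>dist p q / m = 1 / c\<close>, so the bound for expanding maps applies with
  \<open>k = 1 / c\<close>; multiplying by \<open>c\<close> gives the claim.\<close>

lemma emeasure_le_hausdorff1_closed_segment: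
  fixes p q :: "'a::real_normed_vector"
  assumes "p \<noteq> q" "c > 0" and m: "m = c * dist p q"
    and S: "S \<in> sets borel" "S \<subseteq> {a..a + m}"
    and img: "\<And>t. t \<in> S \<Longrightarrow> p + ((t - a) / m) *\<^sub>R (q - p) \<in> A"
  shows "emeasure lborel S \<le> ennreal c * hausdorff1 (A \<inter> closed_segment p q)"
proof -
  define \<gamma> where "\<gamma> t = p + ((t - a) / m) *\<^sub>R (q - p)" for t
  have "m > 0"
    using assms by simp
  have "ennreal (1 / c) * emeasure lborel S \<le> hausdorff1 (A \<inter> closed_segment p q)"
  proof (rule emeasure_le_hausdorff1[OF S(1), of _ \<gamma>])
    fix s t
    have "\<gamma> s - \<gamma> t = ((s - t) / m) *\<^sub>R (q - p)"
      by (simp add: \<gamma>_def diff_divide_distrib flip: scaleR_left_diff_distrib)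
    then have "dist (\<gamma> s) (\<gamma> t) = \<bar>s - t\<bar> / m * dist p q"
      using \<open>m > 0\<close> by (simp add: dist_norm norm_minus_commute)
    then show "1 / c * \<bar>s - t\<bar> \<le> dist (\<gamma> s) (\<gamma> t)"
      using assms(1,2) by (simp add: m)
  next
    have "\<gamma> t \<in> closed_segment p q" if "t \<in> S" for t
    proof -
      have "(t - a) / m \<in> {0..1}"
        using that S(2) \<open>m > 0\<close> by auto
      then show ?thesis
        unfolding closed_segment_image_interval \<gamma>_def
        by (intro image_eqI[of _ _ "(t - a) / m"]) (auto simp: algebra_simps)
    qed
    then show "\<gamma> ` S \<subseteq> A \<inter> closed_segment p q"
      using img by (auto simp: \<gamma>_def)
  qed (use assms(2) in simp)
  then have "ennreal c * (ennreal (1 / c) * emeasure lborel S) \<le> ennreal c * hausdorff1 (A \<inter> closed_segment p q)"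
    by (rule mult_left_mono) simp
  then show ?thesis
    using assms(2) by (simp add: mult.assoc[symmetric] flip: ennreal_mult)
qed

section \<open>Comparison of probability measures and transport of the spectrum\<close>

lemma prob_space_eqI_le:
  assumes "prob_space M" "prob_space N" and sets: "sets M = sets N"
    and le: "\<And>A. A \<in> sets M \<Longrightarrow> emeasure M A \<le> emeasure N A"
  shows "M = N"
proof (rule measure_eqI[OF sets])
  interpret M: prob_space M by fact
  interpret N: prob_space N by fact
  have le': "measure M A \<le> measure N A" if "A \<in> sets M" for A
    using le[OF that] by (simp add: M.emeasure_eq_measure N.emeasure_eq_measure)
  fix A assume A: "A \<in> sets M"
  \<comment> \<open>With total masses equal, the inequality for the complement is the reverse
    inequality for \<open>A\<close>.\<close>
  have "measure M (space M - A) \<le> measure N (space N - A)"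
    using le'[of "space M - A"] A sets.compl_sets sets_eq_imp_space_eq[OF sets] by metis
  then have "measure N A \<le> measure M A"
    using A sets by (simp add: M.prob_compl N.prob_compl)
  with le'[OF A] show "emeasure M A = emeasure N A"
    by (simp add: M.emeasure_eq_measure N.emeasure_eq_measure)
qed

text \<open>Composed with \<open>\<phi>\<close>, the exponential of frequency \<open>n\<close> times
  \<open>u\<close> is \<open>cexp (of_int n * t)\<close> up to the unimodular constant
  \<open>cexp (of_int n * c)\<close>. Orthonormality and density thus carry over from the unit
  interval.\<close>

lemma is_spectrum_distr:
  fixes \<phi> :: "real \<Rightarrow> 'a::euclidean_space"
  assumes \<phi> [measurable]: "\<phi> \<in> borel_measurable unit_interval_measure"
    and u: "\<And>t. t \<in> {0..1} \<Longrightarrow> u \<bullet> \<phi> t = c + t"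
  shows "is_spectrum (distr unit_interval_measure borel \<phi>) (range (\<lambda>n::int. of_int n *\<^sub>R u))"
proof -
  let ?M = unit_interval_measure
  let ?\<mu> = "distr ?M borel \<phi>"
  let ?freq = "\<lambda>n::int. of_int n *\<^sub>R u"
  let ?e = "\<lambda>l x. cexp (l \<bullet> x)"
  have "u \<noteq> 0"
    using u[of 0] u[of 1] by auto
  then have inj: "inj ?freq"
    by (auto intro!: injI)
  have e_meas [measurable]: "?e l \<in> borel_measurable borel" for l :: 'a
    by (intro borel_measurable_continuous_onI continuous_intros)
  have e_\<phi>: "?e (?freq n) (\<phi> t) = cexp (of_int n * c) * cexp (of_int n * t)" if "t \<in> {0..1}" for n t
    using u[OF that] by (simp add: ring_distribs exp_add)
  have "prob_space ?\<mu>"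
    by (rule unit_interval.prob_space_distr) simp
  then interpret \<mu>: prob_space ?\<mu> .
  have "?e l \<in> L2_fun ?\<mu>" for l
    by (rule \<mu>.L2_fun_bounded[of _ 1]) auto
  moreover have "L2_inner ?\<mu> (?e (?freq n)) (?e (?freq m)) = (if ?freq n = ?freq m then 1 else 0)" for n m
  proof -
    have "L2_inner ?\<mu> (?e (?freq n)) (?e (?freq m)) = (LINT t|?M. ?e (?freq n) (\<phi> t) * cnj (?e (?freq m) (\<phi> t)))"
      unfolding L2_inner_def
      by (intro integral_distr \<phi> borel_measurable_continuous_onI continuous_intros)
    also have "\<dots> = (LINT t|?M. cexp (of_int (n - m) * c) * cexp (of_int (n - m) * t))"
    proof (rule Bochner_Integration.integral_cong)
      fix t assume "t \<in> space ?M"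
      then have t: "t \<in> {0..1}" by simp
      have "cexp (of_int n * c) * cexp (of_int n * t) * (cexp (- (of_int m * c)) * cexp (- (of_int m * t)))
          = cexp (of_int (n - m) * c) * cexp (of_int (n - m) * t)"
        unfolding cexp_add[symmetric] by (simp add: algebra_simps)
      then show "?e (?freq n) (\<phi> t) * cnj (?e (?freq m) (\<phi> t)) = cexp (of_int (n - m) * c) * cexp (of_int (n - m) * t)"
        unfolding e_\<phi>[OF t] complex_cnj_mult cnj_cexp .
    qed simp
    also have "\<dots> = cexp (of_int (n - m) * c) * (if n - m = 0 then 1 else 0)"
      by (simp only: integral_mult_right_zero integral_cexp)
    also have "\<dots> = (if ?freq n = ?freq m then 1 else 0)"
      using \<open>u \<noteq> 0\<close> by auto
    finally show ?thesis .
  qed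
  moreover have "\<exists>F a. finite F \<and> F \<subseteq> range ?freq \<and> L2_norm ?\<mu> (\<lambda>x. f x - (\<Sum>l\<in>F. a l * ?e l x)) < \<epsilon>"
    if f: "f \<in> L2_fun ?\<mu>" and "\<epsilon> > 0" for f \<epsilon>
  proof -
    have [measurable]: "f \<in> borel_measurable borel"
      using f by (simp add: L2_fun_def)
    have "(\<lambda>t. f (\<phi> t)) \<in> L2_fun ?M"
      using f by (auto simp: L2_fun_def integrable_distr_eq)
    then obtain p where p: "trig_poly p" "L2_norm ?M (\<lambda>t. f (\<phi> t) - p t) < \<epsilon>"
      using trig_poly_dense \<open>\<epsilon> > 0\<close> by blast
    obtain F a where F: "finite F" "\<And>t. p t = (\<Sum>n\<in>F. a n * cexp (of_int n * t))"
      using trig_poly_eq_sum[OF p(1)] by blast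
    \<comment> \<open>The extra factor cancels the phase \<open>cexp (of_int n * c)\<close>;
      \<open>n\<close> is recovered from \<open>l\<close> by injectivity of the frequency
      map.\<close>
    define b where "b l = (let n = inv ?freq l in a n * cexp (- (of_int n * c)))" for l
    have b: "b (?freq n) = a n * cexp (- (of_int n * c))" for n
      unfolding b_def Let_def inv_f_f[OF inj] ..
    have sum: "(\<Sum>l\<in>?freq ` F. b l * ?e l (\<phi> t)) = p t" if t: "t \<in> {0..1}" for t
    proof -
      have "(\<Sum>l\<in>?freq ` F. b l * ?e l (\<phi> t)) = (\<Sum>n\<in>F. b (?freq n) * ?e (?freq n) (\<phi> t))"
        using inj by (subst sum.reindex) (auto intro: inj_on_subset)
      also have "\<dots> = (\<Sum>n\<in>F. a n * (cexp (- (of_int n * c)) * cexp (of_int n * c)) * cexp (of_int n * t))"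
        unfolding b e_\<phi>[OF t] by (simp only: mult.assoc)
      also have "\<dots> = p t"
        unfolding F(2) cexp_add[symmetric] by simp
      finally show ?thesis .
    qed
    have "(LINT x|?\<mu>. (cmod (f x - (\<Sum>l\<in>?freq ` F. b l * ?e l x)))\<^sup>2)
        = (LINT t|?M. (cmod (f (\<phi> t) - (\<Sum>l\<in>?freq ` F. b l * ?e l (\<phi> t))))\<^sup>2)"
      by (rule integral_distr) auto
    also have "\<dots> = (LINT t|?M. (cmod (f (\<phi> t) - p t))\<^sup>2)"
      using sum by (intro Bochner_Integration.integral_cong) auto
    finally have "L2_norm ?\<mu> (\<lambda>x. f x - (\<Sum>l\<in>?freq ` F. b l * ?e l x)) < \<epsilon>"
      using p(2) by (simp only: L2_norm_def)
    then show ?thesis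
      using F(1) by (intro exI[of _ "?freq ` F"] exI[of _ b]) auto
  qed
  ultimately show ?thesis
    unfolding is_spectrum_def L2_orthonormal_basis_def by (auto simp del: scaleR_left_imp_eq)
qed

section \<open>The measure on two non-coplanar segments\<close>

theorem theorem2:
  fixes \<mu> :: "(real ^ 'd) measure"
    and p1 q1 p2 q2 :: "real ^ 'd"
    and I1 I2 :: "(real ^ 'd) set"
    and c1 c2 :: real
  assumes "CARD('d) \<ge> 3"
    and "p1 \<noteq> q1" and "I1 = closed_segment p1 q1"
    and "p2 \<noteq> q2" and "I2 = closed_segment p2 q2"
    and "non_coplanar I1 I2"
    and "c1 > 0" and "c2 > 0"
    and "prob_space \<mu>" and "sets \<mu> = sets borel"
    and "\<And>A. A \<in> sets borel \<Longrightarrow>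
           emeasure \<mu> A = ennreal c1 * hausdorff1 (A \<inter> I1) + ennreal c2 * hausdorff1 (A \<inter> I2)"
  shows "spectral_measure \<mu> \<and> (\<exists>\<Lambda> L. is_spectrum \<mu> \<Lambda> \<and> straight_line L \<and> \<Lambda> \<subseteq> L)"
proof -
  define m1 m2 where "m1 = c1 * dist p1 q1" and "m2 = c2 * dist p2 q2"
  have pos: "m1 > 0" "m2 > 0"
    using assms by (auto simp: m1_def m2_def)
  interpret \<mu>: prob_space \<mu> by fact
  \<comment> \<open>The exact length of a segment is used here, to compute the total mass.\<close>
  have total: "m1 + m2 = 1"
  proof -
    have "ennreal 1 = emeasure \<mu> UNIV"
      using \<mu>.emeasure_space_1 sets_eq_imp_space_eq[OF assms(10)] by simp
    also have "\<dots> = ennreal (m1 + m2)"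
      using assms(7,8) pos
      by (simp add: assms(3,5,11) hausdorff1_closed_segment m1_def m2_def ennreal_mult)
    finally show ?thesis
      using pos by (subst (asm) ennreal_inj) auto
  qed
  obtain u where u: "u \<bullet> (q1 - p1) = m1" "u \<bullet> (q2 - p2) = m2" "u \<bullet> (p2 - p1) = m1"
  proof (rule inner_values_on_triple)
    have "DIM(real ^ 'd) \<ge> 2" "non_coplanar (closed_segment p1 q1) (closed_segment p2 q2)"
      using assms(1,3,5,6) by auto
    then show "independent {q1 - p1, q2 - p2, p2 - p1}" "card {q1 - p1, q2 - p2, p2 - p1} = 3"
      by (rule non_coplanar_imp_independent)+
  qed
  define \<phi>1 \<phi>2 where "\<phi>1 t = p1 + (t / m1) *\<^sub>R (q1 - p1)"
    and "\<phi>2 t = p2 + ((t - m1) / m2) *\<^sub>R (q2 - p2)" for t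
  \<comment> \<open>A right inverse of the projection along \<open>u\<close>, shifted to start at 0.
    At \<open>m1\<close> it jumps from the end \<open>q1\<close> of the first segment to
    \<open>p2\<close>, and the inner product with \<open>u\<close> agrees at these two
    points.\<close>
  define \<phi> where "\<phi> t = (if t < m1 then \<phi>1 t else \<phi>2 t)" for t
  have [measurable]: "\<phi>1 \<in> borel_measurable borel" "\<phi>2 \<in> borel_measurable borel"
    unfolding \<phi>1_def \<phi>2_def by measurable
  have \<phi>_borel [measurable]: "\<phi> \<in> borel_measurable borel"
    unfolding \<phi>_def by measurable
  have \<phi>_meas [measurable]: "\<phi> \<in> borel_measurable unit_interval_measure"
    by (intro measurable_restrict_space1 measurable_completion) simp
  have u_\<phi>: "u \<bullet> \<phi> t = u \<bullet> p1 + t" for t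
    using u pos by (auto simp: \<phi>_def \<phi>1_def \<phi>2_def inner_add_right inner_diff_right field_simps)
  have "distr unit_interval_measure borel \<phi> = \<mu>"
  proof (rule prob_space_eqI_le)
    show "prob_space (distr unit_interval_measure borel \<phi>)"
      by (rule unit_interval.prob_space_distr) simp
    fix A :: "(real ^ 'd) set" assume "A \<in> sets (distr unit_interval_measure borel \<phi>)"
    then have A [measurable]: "A \<in> sets borel" by simp
    \<comment> \<open>The first interval is half-open, so the two parts of the preimage of
      \<open>A\<close> are disjoint and their measures add.\<close>
    define S1 S2 where "S1 = {0..<m1} \<inter> \<phi>1 -` A" and "S2 = {m1..1} \<inter> \<phi>2 -` A"
    have borel: "S1 \<in> sets borel" "S2 \<in> sets borel"
      using measurable_sets_borel[of \<phi>1 borel A] measurable_sets_borel[of \<phi>2 borel A]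
      by (auto simp: S1_def S2_def)
    have "\<phi> -` A \<inter> {0..1} = S1 \<union> S2"
      using pos total by (auto simp: S1_def S2_def \<phi>_def split: if_splits)
    then have "emeasure (distr unit_interval_measure borel \<phi>) A = emeasure lborel (S1 \<union> S2)"
    proof -
      have "S1 \<union> S2 \<subseteq> {0..1}"
        using pos total by (auto simp: S1_def S2_def)
      then show ?thesis
        using borel \<open>\<phi> -` A \<inter> {0..1} = S1 \<union> S2\<close> by (simp add: emeasure_distr emeasure_restrict_space)
    qed
    also have "\<dots> = emeasure lborel S1 + emeasure lborel S2"
      using borel by (intro plus_emeasure[symmetric]) (auto simp: S1_def S2_def)
    also have "\<dots> \<le> ennreal c1 * hausdorff1 (A \<inter> I1) + ennreal c2 * hausdorff1 (A \<inter> I2)"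
      using assms pos total borel unfolding assms(3,5)
      by (intro add_mono emeasure_le_hausdorff1_closed_segment[where a = 0 and m = m1]
            emeasure_le_hausdorff1_closed_segment[where a = m1 and m = m2])
         (auto simp: S1_def S2_def m1_def m2_def \<phi>1_def \<phi>2_def)
    finally show "emeasure (distr unit_interval_measure borel \<phi>) A \<le> emeasure \<mu> A"
      using assms(11)[OF A] by simp
  qed (use assms in auto)
  then have spectrum: "is_spectrum \<mu> (range (\<lambda>n::int. of_int n *\<^sub>R u))"
    using is_spectrum_distr[OF \<phi>_meas u_\<phi>] by simp
  have "u \<noteq> 0"
    using u pos by auto
  then have "straight_line (span {u})"
    by (simp add: straight_line_def aff_dim_subspace subspace_imp_affine)
  moreover have "range (\<lambda>n::int. of_int n *\<^sub>R u) \<subseteq> span {u}"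
    by (auto simp: span_base span_scale)
  ultimately show ?thesis
    using spectrum assms(9,10) unfolding spectral_measure_def by blast
qed

end
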